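(* For every co-prime pair $(m,n)$ of nonnegative integers with $m\ge1$: if $m>1$ and $\mathrm{Split}(m,n)=(a,b)+(c,d)$ then $Q_{m,n}=\frac1M[Q_{c,d},Q_{a,b}]$, and if $m=1$ then $Q_{1,n}=D_n$.
   Context: Work over $\mathbb{Q}(q,t)$; $\Lambda$ is the algebra of symmetric functions in $X=x_1+x_2+\cdots$, with plethystic notation ($p_k[E]$ = $E$ with all variables including $q,t$ raised to the $k$-th power) and $\Omega[E]=\exp(\sum_{k\ge1}p_k[E]/k)$. $M=(1-t)(1-q)$. For $k\in\mathbb{Z}$, $D_kF[X]=F[X+\tfrac Mz]\Omega[-zX]|_{z^k}$ (coefficient of $z^k$). $\underline{e}_1$ is multiplication by $e_1[X]$; $[A,B]=AB-BA$. Split: for co-prime $m,n>1$, let $(a,b)$ be the unique pair with $1\le a\le m-1$, $1\le b\le n-1$, $mb+1=na$, and set $\mathrm{Split}(m,n)=(a,b)+(c,d)$ with $(c,d)=(m-a,n-b)$; also $\mathrm{Split}(1,n)=(1,n-1)+(0,1)$ for $n\ge1$ and $\mathrm{Split}(m,1)=(1,0)+(m-1,1)$ for $m\ge1$. The operators $Q_{m,n}$, for co-prime nonnegative pairs $(m,n)\ne(0,0)$, are defined by $Q_{1,0}=D_0$, $Q_{0,1}=-\underline{e}_1$, and recursively $Q_{m,n}=\frac1M[Q_{c,d},Q_{a,b}]$ whenever $m,n\ge1$ and $\mathrm{Split}(m,n)=(a,b)+(c,d)$. *)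

theory Defs
  imports
    "HOL-Computational_Algebra.Computational_Algebra"
    "HOL-Library.Poly_Mapping"
    "HOL-Number_Theory.Cong"
begin

unbundle fps_syntax

section \<open>The algebra of symmetric functions\<close>

text \<open>
  A monomial in the variables \<open>x\<^sub>0, x\<^sub>1, x\<^sub>2, \<dots>\<close> is the multiset of the indices of its factors,
  so monomials multiply by multiset sum, have degree \<^const>\<open>size\<close>, and the \<open>k\<close>-th power of a
  monomial is \<^const>\<open>repeat_mset\<close> \<open>k\<close>. A symmetric function is a formal power series (a function
  from monomials to coefficients) of bounded degree that is invariant under all permutations
  of the variables.
\<close>

typedef (overloaded) 'a symfun =
  "{f :: nat multiset \<Rightarrow> 'a::zero.
      (\<exists>d. \<forall>\<mu>. size \<mu> > d \<longrightarrow> f \<mu> = 0) \<and> (\<forall>\<pi> \<mu>. bij \<pi> \<longrightarrow> f (image_mset \<pi> \<mu>) = f \<mu>)}"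
  morphisms scoeff Abs_symfun
  by (rule exI[of _ "\<lambda>_. 0"]) simp

setup_lifting type_definition_symfun

lemma symfun_eqI: "(\<And>\<mu>. scoeff f \<mu> = scoeff g \<mu>) \<Longrightarrow> f = g"
  by (metis ext scoeff_inject)

lemma finite_mset_splits: "finite {(\<alpha>, \<beta>). \<alpha> + \<beta> = (\<mu> :: 'b multiset)}"
proof (rule finite_subset)
  have *: "finite {\<alpha>. \<alpha> \<subseteq># \<mu>}"
  proof (induction \<mu>)
    case (add x \<mu>)
    have "{\<alpha>. \<alpha> \<subseteq># add_mset x \<mu>} \<subseteq> {\<alpha>. \<alpha> \<subseteq># \<mu>} \<union> add_mset x ` {\<alpha>. \<alpha> \<subseteq># \<mu>}"
    proof
      fix \<alpha> assume "\<alpha> \<in> {\<alpha>. \<alpha> \<subseteq># add_mset x \<mu>}"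
      hence a: "\<alpha> \<subseteq># add_mset x \<mu>" by simp
      show "\<alpha> \<in> {\<alpha>. \<alpha> \<subseteq># \<mu>} \<union> add_mset x ` {\<alpha>. \<alpha> \<subseteq># \<mu>}"
      proof (cases "x \<in># \<alpha>")
        case True
        then obtain \<beta> where "\<alpha> = add_mset x \<beta>" by (metis multi_member_split)
        with a show ?thesis by auto
      next
        case False
        with a have "\<alpha> \<subseteq># \<mu>"
          by (metis add_mset_remove_trivial diff_single_trivial subset_eq_diff_conv add_mset_add_single)
        thus ?thesis by simp
      qed
    qed
    thus ?case using add by (meson finite_UnI finite_imageI finite_subset)
  qed simp
  show "{(\<alpha>, \<beta>). \<alpha> + \<beta> = \<mu>} \<subseteq> {\<alpha>. \<alpha> \<subseteq># \<mu>} \<times> {\<alpha>. \<alpha> \<subseteq># \<mu>}"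
    by auto
  show "finite ({\<alpha>. \<alpha> \<subseteq># \<mu>} \<times> {\<alpha>. \<alpha> \<subseteq># \<mu>})" using * by simp
qed

lemma mset_splits_image:
  assumes "bij \<pi>"
  shows "bij_betw (map_prod (image_mset \<pi>) (image_mset \<pi>))
           {(\<alpha>, \<beta>). \<alpha> + \<beta> = \<mu>} {(\<alpha>, \<beta>). \<alpha> + \<beta> = image_mset \<pi> \<mu>}"
proof (rule bij_betw_byWitness[where f' = "map_prod (image_mset (inv \<pi>)) (image_mset (inv \<pi>))"])
  have l: "image_mset (inv \<pi>) (image_mset \<pi> \<alpha>) = \<alpha>" for \<alpha>
    using assms by (simp add: multiset.map_comp bij_is_inj)
  have r: "image_mset \<pi> (image_mset (inv \<pi>) \<alpha>) = \<alpha>" for \<alpha>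
    using assms by (simp add: multiset.map_comp comp_def bij_is_surj surj_f_inv_f)
  show "\<forall>a\<in>{(\<alpha>, \<beta>). \<alpha> + \<beta> = \<mu>}. map_prod (image_mset (inv \<pi>)) (image_mset (inv \<pi>))
          (map_prod (image_mset \<pi>) (image_mset \<pi>) a) = a"
    using l by auto
  show "\<forall>a\<in>{(\<alpha>, \<beta>). \<alpha> + \<beta> = image_mset \<pi> \<mu>}. map_prod (image_mset \<pi>) (image_mset \<pi>)
          (map_prod (image_mset (inv \<pi>)) (image_mset (inv \<pi>)) a) = a"
    using r by auto
  show "map_prod (image_mset \<pi>) (image_mset \<pi>) ` {(\<alpha>, \<beta>). \<alpha> + \<beta> = \<mu>}
          \<subseteq> {(\<alpha>, \<beta>). \<alpha> + \<beta> = image_mset \<pi> \<mu>}"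
    by auto
  show "map_prod (image_mset (inv \<pi>)) (image_mset (inv \<pi>)) ` {(\<alpha>, \<beta>). \<alpha> + \<beta> = image_mset \<pi> \<mu>}
          \<subseteq> {(\<alpha>, \<beta>). \<alpha> + \<beta> = \<mu>}"
    using l by (auto simp flip: image_mset_union)
qed

instantiation symfun :: (comm_ring_1) comm_ring_1
begin

lift_definition zero_symfun :: "'a symfun" is "\<lambda>_. 0" by simp

lift_definition one_symfun :: "'a symfun" is "\<lambda>\<mu>. if \<mu> = {#} then 1 else 0"
  by (auto intro!: exI[of _ 0])

lift_definition plus_symfun :: "'a symfun \<Rightarrow> 'a symfun \<Rightarrow> 'a symfun" is "\<lambda>f g \<mu>. f \<mu> + g \<mu>"
proof -
  fix f g :: "nat multiset \<Rightarrow> 'a"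
  assume f: "(\<exists>d. \<forall>\<mu>. size \<mu> > d \<longrightarrow> f \<mu> = 0) \<and> (\<forall>\<pi> \<mu>. bij \<pi> \<longrightarrow> f (image_mset \<pi> \<mu>) = f \<mu>)"
    and g: "(\<exists>d. \<forall>\<mu>. size \<mu> > d \<longrightarrow> g \<mu> = 0) \<and> (\<forall>\<pi> \<mu>. bij \<pi> \<longrightarrow> g (image_mset \<pi> \<mu>) = g \<mu>)"
  then obtain d e where d: "\<forall>\<mu>. size \<mu> > d \<longrightarrow> f \<mu> = 0" and e: "\<forall>\<mu>. size \<mu> > e \<longrightarrow> g \<mu> = 0"
    by blast
  hence "\<forall>\<mu>. size \<mu> > max d e \<longrightarrow> f \<mu> + g \<mu> = 0" by simp
  thus "(\<exists>d. \<forall>\<mu>. size \<mu> > d \<longrightarrow> f \<mu> + g \<mu> = 0) \<and>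
        (\<forall>\<pi> \<mu>. bij \<pi> \<longrightarrow> f (image_mset \<pi> \<mu>) + g (image_mset \<pi> \<mu>) = f \<mu> + g \<mu>)"
    using f g by metis
qed

lift_definition uminus_symfun :: "'a symfun \<Rightarrow> 'a symfun" is "\<lambda>f \<mu>. - f \<mu>"
  by auto

definition minus_symfun :: "'a symfun \<Rightarrow> 'a symfun \<Rightarrow> 'a symfun" where
  "minus_symfun f g = f + (- g)"

lift_definition times_symfun :: "'a symfun \<Rightarrow> 'a symfun \<Rightarrow> 'a symfun" is
  "\<lambda>f g \<mu>. \<Sum>(\<alpha>, \<beta>) | \<alpha> + \<beta> = \<mu>. f \<alpha> * g \<beta>"
proof -
  fix f g :: "nat multiset \<Rightarrow> 'a"
  assume f: "(\<exists>d. \<forall>\<mu>. size \<mu> > d \<longrightarrow> f \<mu> = 0) \<and> (\<forall>\<pi> \<mu>. bij \<pi> \<longrightarrow> f (image_mset \<pi> \<mu>) = f \<mu>)"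
    and g: "(\<exists>d. \<forall>\<mu>. size \<mu> > d \<longrightarrow> g \<mu> = 0) \<and> (\<forall>\<pi> \<mu>. bij \<pi> \<longrightarrow> g (image_mset \<pi> \<mu>) = g \<mu>)"
  then obtain d e where d: "\<And>\<mu>. size \<mu> > d \<Longrightarrow> f \<mu> = 0" and e: "\<And>\<mu>. size \<mu> > e \<Longrightarrow> g \<mu> = 0"
    by blast
  have "(\<Sum>(\<alpha>, \<beta>) | \<alpha> + \<beta> = \<mu>. f \<alpha> * g \<beta>) = 0" if "size \<mu> > d + e" for \<mu>
  proof (rule sum.neutral, safe)
    fix \<alpha> \<beta> assume "\<mu> = \<alpha> + \<beta>"
    hence "size \<alpha> > d \<or> size \<beta> > e" using that by auto
    thus "f \<alpha> * g \<beta> = 0" using d e by auto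
  qed
  moreover have "(\<Sum>(\<alpha>, \<beta>) | \<alpha> + \<beta> = image_mset \<pi> \<mu>. f \<alpha> * g \<beta>) = (\<Sum>(\<alpha>, \<beta>) | \<alpha> + \<beta> = \<mu>. f \<alpha> * g \<beta>)"
    if "bij \<pi>" for \<pi> \<mu>
    by (subst sum.reindex_bij_betw[OF mset_splits_image[OF that], symmetric])
       (use f g that in \<open>auto intro!: sum.cong\<close>)
  ultimately show "(\<exists>d. \<forall>\<mu>. size \<mu> > d \<longrightarrow> (\<Sum>(\<alpha>, \<beta>) | \<alpha> + \<beta> = \<mu>. f \<alpha> * g \<beta>) = 0) \<and>
     (\<forall>\<pi> \<mu>. bij \<pi> \<longrightarrow> (\<Sum>(\<alpha>, \<beta>) | \<alpha> + \<beta> = image_mset \<pi> \<mu>. f \<alpha> * g \<beta>) = (\<Sum>(\<alpha>, \<beta>) | \<alpha> + \<beta> = \<mu>. f \<alpha> * g \<beta>))"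
    by blast
qed

instance
proof
  fix f g h :: "'a symfun"
  show "f + g + h = f + (g + h)" by transfer (simp add: add.assoc)
  show "f + g = g + f" by transfer (simp add: add.commute)
  show "0 + f = f" by transfer simp
  show "- f + f = 0" by transfer simp
  show "f - g = f + - g" by (rule minus_symfun_def)
  show "(0 :: 'a symfun) \<noteq> 1" by transfer (auto dest: fun_cong[of _ _ "{#}"])
  show "f * g = g * f"
  proof (rule symfun_eqI)
    fix \<mu> :: "nat multiset"
    have "bij_betw prod.swap {(\<alpha>, \<beta>). \<alpha> + \<beta> = \<mu>} {(\<alpha>, \<beta>). \<alpha> + \<beta> = \<mu>}"
      by (rule bij_betw_byWitness[where f' = prod.swap]) (auto simp: add.commute)
    from sum.reindex_bij_betw[OF this, of "\<lambda>(\<alpha>, \<beta>). scoeff f \<alpha> * scoeff g \<beta>", symmetric]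
    show "scoeff (f * g) \<mu> = scoeff (g * f) \<mu>"
      by (simp add: times_symfun.rep_eq case_prod_unfold mult.commute)
  qed
  show "(f + g) * h = f * h + g * h"
    by (rule symfun_eqI)
       (simp add: times_symfun.rep_eq plus_symfun.rep_eq case_prod_unfold distrib_right sum.distrib)
  show "1 * f = f"
  proof (rule symfun_eqI)
    fix \<mu> :: "nat multiset"
    have "scoeff (1 * f) \<mu> = (\<Sum>(\<alpha>, \<beta>)\<in>{({#}, \<mu>)}. scoeff 1 \<alpha> * scoeff f \<beta>)"
      unfolding times_symfun.rep_eq
      by (rule sum.mono_neutral_right) (auto simp: finite_mset_splits one_symfun.rep_eq split: if_splits)
    thus "scoeff (1 * f) \<mu> = scoeff f \<mu>" by (simp add: one_symfun.rep_eq)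
  qed
  show "f * g * h = f * (g * h)"
  proof (rule symfun_eqI)
    fix \<mu> :: "nat multiset"
    let ?L = "SIGMA p:{(\<alpha>, \<beta>). \<alpha> + \<beta> = \<mu>}. {(\<alpha>, \<beta>). \<alpha> + \<beta> = fst p}"
    let ?R = "SIGMA p:{(\<alpha>, \<beta>). \<alpha> + \<beta> = \<mu>}. {(\<alpha>, \<beta>). \<alpha> + \<beta> = snd p}"
    have "scoeff (f * g * h) \<mu> = (\<Sum>(p, r)\<in>?L. scoeff f (fst r) * scoeff g (snd r) * scoeff h (snd p))"
      by (simp add: times_symfun.rep_eq case_prod_unfold sum_distrib_right
          sum.Sigma[unfolded case_prod_unfold] finite_mset_splits[unfolded case_prod_unfold])
    also have "\<dots> = (\<Sum>(p, r)\<in>?R. scoeff f (fst p) * (scoeff g (fst r) * scoeff h (snd r)))"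
      by (rule sum.reindex_bij_witness[
            where i = "\<lambda>(p, r). ((fst p + fst r, snd r), (fst p, fst r))"
              and j = "\<lambda>(p, r). ((fst r, snd r + snd p), (snd r, snd p))"])
         (auto simp: ac_simps)
    also have "\<dots> = scoeff (f * (g * h)) \<mu>"
      by (simp add: times_symfun.rep_eq case_prod_unfold sum_distrib_left
          sum.Sigma[unfolded case_prod_unfold] finite_mset_splits[unfolded case_prod_unfold])
    finally show "scoeff (f * g * h) \<mu> = scoeff (f * (g * h)) \<mu>" .
  qed
qed

end

lift_definition scale :: "'a::comm_ring_1 \<Rightarrow> 'a symfun \<Rightarrow> 'a symfun" is "\<lambda>c f \<mu>. c * f \<mu>"
  by (metis mult_zero_right)

abbreviation const :: "'a::comm_ring_1 \<Rightarrow> 'a symfun" where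
  "const c \<equiv> scale c 1"

lift_definition elem_sym :: "nat \<Rightarrow> 'a::comm_ring_1 symfun" is
  "\<lambda>k \<mu>. if size \<mu> = k \<and> (\<forall>i. count \<mu> i \<le> 1) then 1 else 0"
proof -
  fix k :: nat
  have *: "(\<forall>i. count (image_mset \<pi> \<mu>) i \<le> 1) \<longleftrightarrow> (\<forall>i. count \<mu> i \<le> 1)" if "bij \<pi>" for \<pi> :: "nat \<Rightarrow> nat" and \<mu>
  proof -
    have "count (image_mset \<pi> \<mu>) (\<pi> i) = count \<mu> i" for i
      using bij_is_inj[OF that] by (induction \<mu>) (auto simp: inj_eq)
    thus ?thesis by (metis bij_pointE that)
  qed
  show "(\<exists>d. \<forall>\<mu>. size \<mu> > d \<longrightarrow>
           (if size \<mu> = k \<and> (\<forall>i. count \<mu> i \<le> 1) then 1 else 0 :: 'a) = 0) \<and>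
        (\<forall>(\<pi> :: nat \<Rightarrow> nat) \<mu>. bij \<pi> \<longrightarrow>
           (if size (image_mset \<pi> \<mu>) = k \<and> (\<forall>i. count (image_mset \<pi> \<mu>) i \<le> 1) then 1 else 0 :: 'a) =
           (if size \<mu> = k \<and> (\<forall>i. count \<mu> i \<le> 1) then 1 else 0))"
    by (intro conjI exI[of _ k] allI impI) (simp, simp only: size_image_mset *)
qed

text \<open>The sum \<open>X = x\<^sub>0 + x\<^sub>1 + x\<^sub>2 + \<dots>\<close> of all variables.\<close>

lift_definition varsum :: "'a::comm_ring_1 symfun" is "\<lambda>\<mu>. if size \<mu> = 1 then 1 else 0"
  by (auto intro!: exI[of _ 1])

section \<open>The ground field\<close>

text \<open>The fraction field of \<open>\<rat>[q][t]\<close>: the inner polynomial variable is \<open>q\<close>, the outer one \<open>t\<close>.\<close>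

type_synonym ratqt = "rat poly poly fract"

definition qq :: ratqt where "qq = Fract [:[:0, 1:]:] 1"

definition tt :: ratqt where "tt = Fract [:0, 1:] 1"

definition MM :: ratqt where "MM = (1 - tt) * (1 - qq)"

definition raise_poly :: "nat \<Rightarrow> rat poly poly \<Rightarrow> rat poly poly" where
  "raise_poly k p = pcompose (map_poly (\<lambda>c. pcompose c (monom 1 k)) p) (monom 1 k)"

lemma raise_poly_mult: "raise_poly k (a * b) = raise_poly k a * raise_poly k b"
proof -
  have "map_poly (\<lambda>c. pcompose c (monom 1 k)) (a * b) =
        map_poly (\<lambda>c. pcompose c (monom 1 k)) a * map_poly (\<lambda>c. pcompose c (monom 1 k)) b"
    by (rule poly_eqI) (simp add: coeff_map_poly coeff_mult pcompose_sum pcompose_mult)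
  thus ?thesis by (simp add: raise_poly_def pcompose_mult)
qed

lemma raise_poly_eq_0_iff:
  assumes "k > 0"
  shows "raise_poly k a = 0 \<longleftrightarrow> a = 0"
proof -
  have *: "pcompose c (monom 1 k) = 0 \<longleftrightarrow> c = 0" for c :: "'b::idom poly"
    using assms by (subst pcompose_eq_0_iff) (simp_all add: degree_monom_eq)
  have "map_poly (\<lambda>c. pcompose c (monom 1 k)) a = 0 \<longleftrightarrow> a = 0"
    by (simp add: poly_eq_iff[of _ "0 :: rat poly poly"] coeff_map_poly *)
  thus ?thesis by (simp add: raise_poly_def *)
qed

text \<open>
  The substitution \<open>q \<mapsto> q\<^sup>k\<close>, \<open>t \<mapsto> t\<^sup>k\<close> on \<open>\<rat>(q,t)\<close>, for \<open>k \<ge> 1\<close>. The value at \<open>k = 0\<close> is never used.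
\<close>

definition raise_qt :: "nat \<Rightarrow> ratqt \<Rightarrow> ratqt" where
  "raise_qt k x = (if k = 0 then 0 else
     (THE y. \<exists>a b. b \<noteq> 0 \<and> x = Fract a b \<and> y = Fract (raise_poly k a) (raise_poly k b)))"

lemma raise_qt_Fract:
  assumes "k > 0" "b \<noteq> 0"
  shows "raise_qt k (Fract a b) = Fract (raise_poly k a) (raise_poly k b)"
proof -
  have "Fract (raise_poly k c) (raise_poly k d) = Fract (raise_poly k a) (raise_poly k b)"
    if "d \<noteq> 0" "Fract a b = Fract c d" for c d
    using that assms by (simp add: eq_fract raise_poly_eq_0_iff flip: raise_poly_mult)
  hence "(THE y. \<exists>c d. d \<noteq> 0 \<and> Fract a b = Fract c d \<and> y = Fract (raise_poly k c) (raise_poly k d)) =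
         Fract (raise_poly k a) (raise_poly k b)"
    using assms by (intro the_equality) blast+
  thus ?thesis using assms by (simp add: raise_qt_def)
qed

lemma raise_qt_0: "raise_qt k 0 = 0"
proof (cases "k = 0")
  case False
  thus ?thesis
    using raise_qt_Fract[of k 1 0] by (simp add: raise_poly_eq_0_iff eq_fract Zero_fract_def)
qed (simp add: raise_qt_def)

text \<open>
  Raising all of \<open>q\<close>, \<open>t\<close> and the \<open>x\<^sub>i\<close> to the \<open>k\<close>-th power. For \<open>k \<ge> 1\<close> the sum below has at most
  one term.
\<close>

lift_definition raise_sym :: "nat \<Rightarrow> ratqt symfun \<Rightarrow> ratqt symfun" is
  "\<lambda>k f \<mu>. \<Sum>\<nu> | repeat_mset k \<nu> = \<mu>. raise_qt k (f \<nu>)"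
proof -
  fix k and f :: "nat multiset \<Rightarrow> ratqt"
  assume f: "(\<exists>d. \<forall>\<mu>. size \<mu> > d \<longrightarrow> f \<mu> = 0) \<and> (\<forall>\<pi> \<mu>. bij \<pi> \<longrightarrow> f (image_mset \<pi> \<mu>) = f \<mu>)"
  then obtain d where d: "\<And>\<mu>. size \<mu> > d \<Longrightarrow> f \<mu> = 0" by blast
  have "(\<Sum>\<nu> | repeat_mset k \<nu> = \<mu>. raise_qt k (f \<nu>)) = 0" if "size \<mu> > k * d" for \<mu>
    by (rule sum.neutral) (use that d in \<open>auto simp: raise_qt_0\<close>)
  moreover have "(\<Sum>\<nu> | repeat_mset k \<nu> = image_mset \<pi> \<mu>. raise_qt k (f \<nu>)) =
                 (\<Sum>\<nu> | repeat_mset k \<nu> = \<mu>. raise_qt k (f \<nu>))" if "bij \<pi>" for \<pi> \<mu>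
  proof -
    have l: "image_mset (inv \<pi>) (image_mset \<pi> \<alpha>) = \<alpha>" for \<alpha>
      using that by (simp add: multiset.map_comp bij_is_inj)
    have r: "image_mset \<pi> (image_mset (inv \<pi>) \<alpha>) = \<alpha>" for \<alpha>
      using that by (simp add: multiset.map_comp comp_def bij_is_surj surj_f_inv_f)
    have rep: "image_mset \<rho> (repeat_mset k \<alpha>) = repeat_mset k (image_mset \<rho> \<alpha>)"
      for \<rho> :: "nat \<Rightarrow> nat" and \<alpha>
      by (induction k) auto
    show ?thesis
      by (rule sum.reindex_bij_witness[where i = "image_mset \<pi>" and j = "image_mset (inv \<pi>)"])
         (use f that bij_imp_bij_inv[OF that] in \<open>auto simp: l r simp flip: rep\<close>)
  qed
  ultimately show "(\<exists>d. \<forall>\<mu>. size \<mu> > d \<longrightarrow> (\<Sum>\<nu> | repeat_mset k \<nu> = \<mu>. raise_qt k (f \<nu>)) = 0) \<and>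
     (\<forall>\<pi> \<mu>. bij \<pi> \<longrightarrow> (\<Sum>\<nu> | repeat_mset k \<nu> = image_mset \<pi> \<mu>. raise_qt k (f \<nu>)) =
                      (\<Sum>\<nu> | repeat_mset k \<nu> = \<mu>. raise_qt k (f \<nu>)))"
    by blast
qed

section \<open>Plethysm\<close>

text \<open>
  Plethystic expressions are Laurent series in \<open>z\<close> over the symmetric functions; \<open>pleth_p k E\<close> is
  \<open>p\<^sub>k[E]\<close>, that is, \<open>E\<close> with all of its variables (\<open>q\<close>, \<open>t\<close>, \<open>z\<close> and the \<open>x\<^sub>i\<close>) raised to the
  \<open>k\<close>-th power.
\<close>

definition pleth_p :: "nat \<Rightarrow> ratqt symfun fls \<Rightarrow> ratqt symfun fls" where
  "pleth_p k E = fls_compose_power (Abs_fls (\<lambda>n. raise_sym k (E $$ n))) k"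

definition power_sum :: "nat \<Rightarrow> ratqt symfun" where
  "power_sum k = raise_sym k varsum"

text \<open>
  The unique expansion \<open>F = \<Sum> c\<^sub>\<nu> p\<^sub>\<nu>\<close> of a symmetric function in power sums, partitions \<open>\<nu>\<close> being
  the multisets of their (positive) parts; that is, \<open>F\<close> as a polynomial in \<open>p\<^sub>1, p\<^sub>2, \<dots>\<close>.
\<close>

definition power_sum_expansion :: "ratqt symfun \<Rightarrow> (nat multiset \<Rightarrow>\<^sub>0 ratqt)" where
  "power_sum_expansion F = (THE c. (\<forall>\<nu>\<in>Poly_Mapping.keys c. 0 \<notin># \<nu>) \<and>
     F = (\<Sum>\<nu>\<in>Poly_Mapping.keys c. scale (Poly_Mapping.lookup c \<nu>) (\<Prod>k\<in>#\<nu>. power_sum k)))"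

text \<open>\<open>F[E]\<close>: substitute \<open>p\<^sub>k[E]\<close> for \<open>p\<^sub>k\<close>, leaving the coefficients of \<open>F\<close> alone.\<close>

definition plethysm :: "ratqt symfun \<Rightarrow> ratqt symfun fls \<Rightarrow> ratqt symfun fls" where
  "plethysm F E = (\<Sum>\<nu>\<in>Poly_Mapping.keys (power_sum_expansion F).
     fls_const (const (Poly_Mapping.lookup (power_sum_expansion F) \<nu>)) * (\<Prod>k\<in>#\<nu>. pleth_p k E))"

text \<open>
  \<open>\<Omega>[E] = exp (\<Sum>\<^bsub>k\<ge>1\<^esub> p\<^sub>k[E] / k)\<close> for \<open>E\<close> divisible by \<open>z\<close>. Then \<open>p\<^sub>k[E]\<close> is divisible by \<open>z\<^sup>k\<close>, so
  only \<open>k \<le> n\<close> contribute to the coefficient of \<open>z\<^sup>n\<close> in the inner sum, and that sum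
  has no constant term, so that it can be substituted into the exponential series.
\<close>

definition Omega :: "ratqt symfun fls \<Rightarrow> ratqt symfun fps" where
  "Omega E = fps_compose (Abs_fps (\<lambda>j. const (1 / fact j)))
     (Abs_fps (\<lambda>n. \<Sum>k=1..n. scale (1 / of_nat k) (pleth_p k E $$ int n)))"

section \<open>The operators\<close>

type_synonym sym_op = "ratqt symfun \<Rightarrow> ratqt symfun"

definition D_op :: "int \<Rightarrow> sym_op" where
  "D_op k F =
     (plethysm F (fls_const varsum + fls_const (const MM) * fls_X_inv)
        * fps_to_fls (Omega (- (fls_X * fls_const varsum)))) $$ k"

definition e1_op :: sym_op where
  "e1_op F = elem_sym 1 * F"

definition commutator :: "sym_op \<Rightarrow> sym_op \<Rightarrow> sym_op" where
  "commutator A B = (\<lambda>F. A (B F) - B (A F))"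

text \<open>
  \<open>Split m n = ((a, b), (c, d))\<close> stands for \<open>Split(m,n) = (a,b) + (c,d)\<close>; it is meaningful
  for coprime \<open>m, n \<ge> 1\<close>.
\<close>

definition Split :: "nat \<Rightarrow> nat \<Rightarrow> (nat \<times> nat) \<times> (nat \<times> nat)" where
  "Split m n =
     (if m = 1 then ((1, n - 1), (0, 1))
      else if n = 1 then ((1, 0), (m - 1, 1))
      else let (a, b) = (THE (a, b). 1 \<le> a \<and> a \<le> m - 1 \<and> 1 \<le> b \<and> b \<le> n - 1 \<and> m * b + 1 = n * a)
           in ((a, b), (m - a, n - b)))"

lemma ex1_Split:
  fixes m n :: nat
  assumes "coprime m n" "m > 1" "n > 1"
  shows "\<exists>!(a, b). 1 \<le> a \<and> a \<le> m - 1 \<and> 1 \<le> b \<and> b \<le> n - 1 \<and> m * b + 1 = n * a"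
proof -
  obtain x y where xy: "n * x = m * y + 1"
    using coprime_bezout_strong[of n m] assms by (auto simp: coprime_commute)
  define a where "a = x mod m"
  have "n * a mod m = 1"
    using xy assms by (metis a_def mod_mult_right_eq mod_mult_self4 mod_less)
  hence "n * a = m * (n * a div m) + 1"
    by (metis mult_div_mod_eq)
  then obtain b where b: "m * b + 1 = n * a" by metis
  have a: "a < m" using assms by (simp add: a_def)
  have "a > 0" using b by (cases a) auto
  have "n > 0" "m > 0" using assms by auto
  have "b < n"
  proof (rule ccontr)
    assume "\<not> b < n"
    hence "m * n \<le> m * b" by simp
    moreover have "n * a \<le> n * m" using a by simp
    ultimately show False using b mult.commute[of m n] by linarith
  qed
  have "b > 0"
    using b \<open>n > 1\<close> by (cases b) auto
  show ?thesis
  proof (rule ex1I[of _ "(a, b)"])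
    show "case (a, b) of (a, b) \<Rightarrow> 1 \<le> a \<and> a \<le> m - 1 \<and> 1 \<le> b \<and> b \<le> n - 1 \<and> m * b + 1 = n * a"
      using a b \<open>a > 0\<close> \<open>b > 0\<close> \<open>b < n\<close> by auto
    fix p :: "nat \<times> nat"
    assume "case p of (a, b) \<Rightarrow> 1 \<le> a \<and> a \<le> m - 1 \<and> 1 \<le> b \<and> b \<le> n - 1 \<and> m * b + 1 = n * a"
    then obtain a' b' where p: "p = (a', b')" "a' \<le> m - 1" "m * b' + 1 = n * a'"
      by (cases p) auto
    have "[n * a' = n * a] (mod m)"
      using b p(3) by (metis cong_def mod_mult_self4)
    hence "[a' = a] (mod m)"
      using assms by (simp add: cong_mult_lcancel_nat coprime_commute)
    hence "a' = a"
      using a p(2) \<open>m > 0\<close> by (simp add: cong_def)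
    moreover from this have "b' = b"
      using b p(3) \<open>m > 0\<close> by (metis add_right_cancel mult_left_cancel less_irrefl)
    ultimately show "p = (a, b)" using p by simp
  qed
qed

lemma Split_less:
  assumes "coprime m n" "m \<ge> 1" "n \<ge> 1" "Split m n = ((a, b), (c, d))"
  shows "a + b < m + n" "c + d < m + n"
proof -
  have "a + b < m + n \<and> c + d < m + n"
  proof (cases "m = 1 \<or> n = 1")
    case True
    thus ?thesis using assms by (auto simp: Split_def split: if_splits)
  next
    case False
    hence "m > 1" "n > 1" using assms by auto
    from theI'[OF ex1_Split[OF assms(1) this]] show ?thesis
      using assms(4) False by (auto simp: Split_def Let_def case_prod_unfold)
  qed
  thus "a + b < m + n" "c + d < m + n" by auto
qed

text \<open>The value \<open>\<lambda>_. 0\<close> is a dummy for the pairs that are not coprime.\<close>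

function Q_op :: "nat \<Rightarrow> nat \<Rightarrow> sym_op" where
  "Q_op m n =
     (if m = 1 \<and> n = 0 then D_op 0
      else if m = 0 \<and> n = 1 then (\<lambda>F. - e1_op F)
      else if m \<ge> 1 \<and> n \<ge> 1 \<and> coprime m n then
        (case Split m n of ((a, b), (c, d)) \<Rightarrow>
           (\<lambda>F. scale (1 / MM) (commutator (Q_op c d) (Q_op a b) F)))
      else (\<lambda>_. 0))"
  by pat_completeness auto
termination
  by (relation "measure (\<lambda>(m, n). m + n)") (auto dest: Split_less Split_less[OF _ _ _ sym])

declare Q_op.simps [simp del]

end

theory Submission
  imports Defs "HOL-Combinatorics.Permutations"
begin

text \<open>
  Since \<open>e\<^sub>1[X + M/z] = e\<^sub>1 + M/z\<close>, and \<open>F \<mapsto> F[X + M/z]\<close> is multiplicative, comparing coefficients of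
  \<open>z\<^sup>n\<close> gives \<open>D\<^sub>n e\<^sub>1 - e\<^sub>1 D\<^sub>n = M D\<^bsub>n+1\<^esub>\<close>, from which \<open>Q\<^bsub>1,n\<^esub> = D\<^sub>n\<close> follows by induction on \<open>n\<close>.
  As plethysm is defined through the expansion in power sums, this rests on the \<open>p\<^sub>\<nu>\<close> being a basis
  of the symmetric functions. They are, because the coefficient in \<open>p\<^sub>\<nu>\<close> of a monomial \<open>x\<^sup>\<mu>\<close> involving
  \<open>l\<close> distinct variables vanishes if \<open>l\<close> exceeds the number of parts of \<open>\<nu>\<close>, and, if the two are equal,
  is nonzero exactly if \<open>\<nu>\<close> is the multiset of the exponents of \<open>x\<^sup>\<mu>\<close>.
\<close>

section \<open>Exponents of monomials\<close>

text \<open>The partition recording the type of a monomial: it classifies the orbits of monomials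
  under permutations of the variables.\<close>

definition exponents :: "'b multiset \<Rightarrow> nat multiset" where
  "exponents \<mu> = image_mset (count \<mu>) (mset_set (set_mset \<mu>))"

lemma size_exponents: "size (exponents \<mu>) = card (set_mset \<mu>)"
  by (simp add: exponents_def)

lemma set_mset_exponents: "set_mset (exponents \<mu>) = count \<mu> ` set_mset \<mu>"
  by (simp add: exponents_def)

lemma set_mset_remove_all: "set_mset (\<mu> - replicate_mset (count \<mu> i) i) = set_mset \<mu> - {i}"
proof (rule set_eqI)
  fix x
  have "count (\<mu> - replicate_mset (count \<mu> i) i) x > 0 \<longleftrightarrow> count \<mu> x > 0 \<and> x \<noteq> i"
    by simp
  thus "x \<in># \<mu> - replicate_mset (count \<mu> i) i \<longleftrightarrow> x \<in> set_mset \<mu> - {i}"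
    unfolding count_greater_zero_iff by simp
qed

lemma exponents_remove_all:
  assumes "i \<in># \<mu>"
  shows "exponents \<mu> = add_mset (count \<mu> i) (exponents (\<mu> - replicate_mset (count \<mu> i) i))"
proof -
  have "mset_set (set_mset \<mu>) = add_mset i (mset_set (set_mset \<mu> - {i}))"
    by (rule mset_set.remove[OF finite_set_mset assms])
  moreover have "image_mset (count \<mu>) (mset_set (set_mset \<mu> - {i})) =
      image_mset (count (\<mu> - replicate_mset (count \<mu> i) i)) (mset_set (set_mset \<mu> - {i}))"
    by (intro image_mset_cong) auto
  ultimately show ?thesis
    by (simp add: exponents_def set_mset_remove_all)
qed

lemma ex_exponents_eq:
  fixes \<nu> :: "nat multiset"
  assumes "0 \<notin># \<nu>"
  shows "\<exists>\<mu> :: nat multiset. exponents \<mu> = \<nu>"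
  using assms
proof (induction \<nu>)
  case empty
  have "exponents ({#} :: nat multiset) = {#}" by (simp add: exponents_def)
  thus ?case by blast
next
  case (add k \<nu>)
  then obtain \<mu> :: "nat multiset" where \<mu>: "exponents \<mu> = \<nu>" by auto
  obtain i where i: "i \<notin> set_mset \<mu>"
    using ex_new_if_finite[OF infinite_UNIV_nat, of "set_mset \<mu>"] by auto
  hence c: "count (\<mu> + replicate_mset k i) i = k" by (simp add: not_in_iff)
  have "k > 0" using add.prems by (cases k) auto
  hence "exponents (\<mu> + replicate_mset k i) = add_mset k \<nu>"
    using exponents_remove_all[of i "\<mu> + replicate_mset k i"] c \<mu> by simp
  thus ?case by blast
qed

text \<open>The supports may differ and overlap, so a bijection between them need not extend to all
  variables by the identity. Their union \<open>A\<close> is therefore permuted as a whole.\<close>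

lemma exponents_eq_imp_permuted:
  fixes \<mu> \<mu>' :: "'b multiset"
  assumes "exponents \<mu> = exponents \<mu>'"
  obtains \<pi> where "bij \<pi>" "image_mset \<pi> \<mu> = \<mu>'"
proof -
  define A where "A = set_mset \<mu> \<union> set_mset \<mu>'"
  \<comment> \<open>Variables of \<open>A\<close> absent from \<open>\<rho>\<close> contribute
    zeros. Their number depends only on \<open>exponents \<rho>\<close>, so equal exponents remain
    equal after padding.\<close>
  have pad: "image_mset (count \<rho>) (mset_set A) =
      exponents \<rho> + replicate_mset (card A - size (exponents \<rho>)) 0"
    if "set_mset \<rho> \<subseteq> A" for \<rho>
  proof -
    have "mset_set A = mset_set (set_mset \<rho>) + mset_set (A - set_mset \<rho>)"
      using that by (subst mset_set_Union[symmetric]) (auto simp: A_def Un_absorb1)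
    moreover have "image_mset (count \<rho>) (mset_set (A - set_mset \<rho>)) =
        image_mset (\<lambda>_. 0) (mset_set (A - set_mset \<rho>))"
      by (intro image_mset_cong) (auto simp: A_def not_in_iff)
    moreover have "card (A - set_mset \<rho>) = card A - size (exponents \<rho>)"
      using that by (simp add: size_exponents card_Diff_subset)
    ultimately show ?thesis
      by (simp add: exponents_def image_mset_const_eq)
  qed
  have fin: "finite A" by (simp add: A_def)
  have "image_mset (count \<mu>) (mset_set A) = image_mset (count \<mu>') (mset_set A)"
    using pad[of \<mu>] pad[of \<mu>'] assms by (simp add: A_def)
  from image_mset_eq_implies_permutes[OF fin this] obtain \<pi>
    where \<pi>: "\<pi> permutes A" "\<forall>x\<in>A. count \<mu> x = count \<mu>' (\<pi> x)" by blast
  have eq: "count \<mu> x = count \<mu>' (\<pi> x)" for x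
  proof (cases "x \<in> A")
    case False
    hence "\<pi> x = x" "x \<notin># \<mu>" "x \<notin># \<mu>'" using \<pi>(1) by (auto simp: A_def permutes_def)
    thus ?thesis by (simp add: not_in_iff)
  qed (use \<pi> in auto)
  have bij: "bij \<pi>" using \<pi>(1) by (rule permutes_bij)
  have cnt: "count (image_mset \<pi> \<mu>) (\<pi> x) = count \<mu> x" for x
    using bij_is_inj[OF bij] by (induction \<mu>) (auto simp: inj_eq)
  have "image_mset \<pi> \<mu> = \<mu>'"
  proof (rule multiset_eqI)
    fix y
    obtain x where "y = \<pi> x" using bij by (metis bij_pointE)
    thus "count (image_mset \<pi> \<mu>) y = count \<mu>' y" using cnt eq by simp
  qed
  with bij show ?thesis by (rule that)
qed

lemma scoeff_cong_exponents:
  assumes "exponents \<mu> = exponents \<mu>'"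
  shows "scoeff f \<mu> = scoeff f \<mu>'"
proof -
  obtain \<pi> where "bij \<pi>" "image_mset \<pi> \<mu> = \<mu>'"
    using exponents_eq_imp_permuted[OF assms] .
  thus ?thesis using scoeff[of f] by auto
qed

section \<open>Products of power sums\<close>

lemma raise_qt_1_right: "k > 0 \<Longrightarrow> raise_qt k 1 = 1"
  using raise_qt_Fract[of k 1 1] by (simp add: One_fract_def raise_poly_def pcompose_1)

text \<open>For \<open>k > 0\<close>, \<open>repeat_mset k\<close> is injective, so the sum defining
  \<open>raise_sym\<close> has at most one term.\<close>

lemma scoeff_power_sum:
  assumes "k > 0"
  shows "scoeff (power_sum k) \<mu> = (if \<exists>i. \<mu> = replicate_mset k i then 1 else 0)"
proof (cases "\<exists>i. \<mu> = replicate_mset k i")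
  case True
  then obtain i where i: "\<mu> = replicate_mset k i" by blast
  have "{\<nu>. repeat_mset k \<nu> = \<mu>} = {{#i#}}"
  proof -
    have "\<mu> = repeat_mset k {#i#}" by (simp add: i)
    hence "repeat_mset k \<nu> = \<mu> \<longleftrightarrow> \<nu> = {#i#}" for \<nu>
      using assms by (simp only: repeat_mset_cancel1) simp
    thus ?thesis by simp
  qed
  thus ?thesis using True assms
    by (simp add: power_sum_def raise_sym.rep_eq varsum.rep_eq raise_qt_1_right)
next
  case False
  have "size \<nu> \<noteq> 1" if "repeat_mset k \<nu> = \<mu>" for \<nu>
  proof
    assume "size \<nu> = 1"
    then obtain i where "\<nu> = {#i#}" using size_1_singleton_mset by blast
    thus False using that False by auto
  qed
  thus ?thesis using False
    by (auto simp: power_sum_def raise_sym.rep_eq varsum.rep_eq raise_qt_0 intro!: sum.neutral)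
qed

text \<open>Only splittings whose first factor is the \<open>k\<close>-th power of a single variable
  survive. This is the recursion behind the inductions on \<open>\<nu>\<close> below.\<close>

lemma scoeff_power_sum_mult:
  assumes "k > 0"
  shows "scoeff (power_sum k * g) \<mu> =
    (\<Sum>i | k \<le> count \<mu> i. scoeff g (\<mu> - replicate_mset k i))"
proof -
  let ?h = "\<lambda>i. (replicate_mset k i, \<mu> - replicate_mset k i)"
  have "scoeff (power_sum k * g) \<mu> =
      (\<Sum>(\<alpha>, \<beta>) \<in> ?h ` {i. k \<le> count \<mu> i}. scoeff (power_sum k) \<alpha> * scoeff g \<beta>)"
    unfolding times_symfun.rep_eq
  proof (rule sum.mono_neutral_right)
    show "?h ` {i. k \<le> count \<mu> i} \<subseteq> {(\<alpha>, \<beta>). \<alpha> + \<beta> = \<mu>}"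
      by (auto simp: count_le_replicate_mset_subset_eq)
    show "\<forall>p \<in> {(\<alpha>, \<beta>). \<alpha> + \<beta> = \<mu>} - ?h ` {i. k \<le> count \<mu> i}.
        (case p of (\<alpha>, \<beta>) \<Rightarrow> scoeff (power_sum k) \<alpha> * scoeff g \<beta>) = 0"
    proof (safe, goal_cases)
      case (1 \<alpha> \<beta>)
      have "\<alpha> \<noteq> replicate_mset k i" for i
        using 1 by (auto simp: image_iff dest: spec[of _ i])
      thus ?case using assms by (simp add: scoeff_power_sum)
    qed
  qed (rule finite_mset_splits)
  also have "\<dots> = (\<Sum>i | k \<le> count \<mu> i. scoeff g (\<mu> - replicate_mset k i))"
    using assms by (subst sum.reindex) (auto simp: inj_on_def replicate_mset_eq_iff scoeff_power_sum)
  finally show ?thesis .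
qed

lemma finite_count_ge: "k > 0 \<Longrightarrow> finite {i. k \<le> count \<mu> i}"
  by (rule finite_subset[of _ "set_mset \<mu>"]) (auto simp flip: count_greater_zero_iff)

abbreviation power_sum_prod :: "nat multiset \<Rightarrow> ratqt symfun" where
  "power_sum_prod \<nu> \<equiv> (\<Prod>k\<in>#\<nu>. power_sum k)"

text \<open>This rules out cancellation, so one positive summand makes a whole coefficient positive.
  The order is that of \<open>ratqt\<close> as the fraction field of an ordered polynomial
  ring.\<close>

lemma scoeff_power_sum_prod_nonneg:
  "0 \<notin># \<nu> \<Longrightarrow> scoeff (power_sum_prod \<nu>) \<mu> \<ge> 0"
proof (induction \<nu> arbitrary: \<mu>)
  case (add k \<nu>)
  thus ?case by (cases k) (auto simp: scoeff_power_sum_mult intro!: sum_nonneg)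
qed (simp add: one_symfun.rep_eq)

lemma scoeff_power_sum_prod_exponents_pos:
  assumes "0 \<notin># \<nu>" "exponents \<mu> = \<nu>"
  shows "scoeff (power_sum_prod \<nu>) \<mu> > 0"
  using assms
proof (induction \<nu> arbitrary: \<mu>)
  case empty
  hence "\<mu> = {#}" using size_exponents[of \<mu>] by simp
  thus ?case by (simp add: one_symfun.rep_eq)
next
  case (add k \<nu>)
  have k: "k > 0" using add.prems by (cases k) auto
  have "k \<in># exponents \<mu>" using add.prems by simp
  then obtain i where i: "i \<in># \<mu>" "count \<mu> i = k" by (auto simp: set_mset_exponents)
  let ?f = "\<lambda>i. scoeff (power_sum_prod \<nu>) (\<mu> - replicate_mset k i)"
  have "exponents (\<mu> - replicate_mset k i) = \<nu>"
    using exponents_remove_all[OF i(1)] i(2) add.prems by simp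
  hence "0 < ?f i" using add by auto
  also have "?f i \<le> (\<Sum>i | k \<le> count \<mu> i. ?f i)"
    by (rule member_le_sum)
       (use i add.prems scoeff_power_sum_prod_nonneg finite_count_ge[OF k] in auto)
  finally show ?case using k by (simp add: scoeff_power_sum_mult)
qed

text \<open>Triangularity: each factor \<open>power_sum k\<close> supplies a power of one variable,
  and the number of parts is attained only if distinct factors supply distinct variables.\<close>

lemma scoeff_power_sum_prod_nonzero:
  assumes "0 \<notin># \<nu>" "scoeff (power_sum_prod \<nu>) \<mu> \<noteq> 0"
  shows "card (set_mset \<mu>) \<le> size \<nu> \<and> (card (set_mset \<mu>) = size \<nu> \<longrightarrow> exponents \<mu> = \<nu>)"
  using assms
proof (induction \<nu> arbitrary: \<mu>)
  case empty
  thus ?case by (auto simp: one_symfun.rep_eq exponents_def split: if_splits)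
next
  case (add k \<nu>)
  have k: "k > 0" using add.prems by (cases k) auto
  have "(\<Sum>i | k \<le> count \<mu> i. scoeff (power_sum_prod \<nu>) (\<mu> - replicate_mset k i)) \<noteq> 0"
    using add.prems k by (simp add: scoeff_power_sum_mult)
  then obtain i where i: "k \<le> count \<mu> i" "scoeff (power_sum_prod \<nu>) (\<mu> - replicate_mset k i) \<noteq> 0"
    using sum.neutral by (metis (no_types, lifting) mem_Collect_eq)
  have i_in: "i \<in># \<mu>" using i(1) k by (simp flip: count_greater_zero_iff)
  have "0 \<notin># \<nu>" using add.prems(1) by simp
  define \<rho> where "\<rho> = \<mu> - replicate_mset k i"
  have IH: "card (set_mset \<rho>) \<le> size \<nu> \<and> (card (set_mset \<rho>) = size \<nu> \<longrightarrow> exponents \<rho> = \<nu>)"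
    unfolding \<rho>_def by (rule add.IH[OF \<open>0 \<notin># \<nu>\<close> i(2)])
  show ?case
  proof (cases "count \<mu> i = k")
    case True
    have "card (set_mset \<mu>) = Suc (card (set_mset \<mu> - {i}))"
      by (rule card.remove[OF finite_set_mset i_in])
    also have "set_mset \<mu> - {i} = set_mset \<rho>"
      unfolding \<rho>_def True[symmetric] by (rule set_mset_remove_all[symmetric])
    finally have "card (set_mset \<mu>) = Suc (card (set_mset \<rho>))" .
    moreover have "exponents \<mu> = add_mset k (exponents \<rho>)"
      unfolding \<rho>_def True[symmetric] by (rule exponents_remove_all[OF i_in])
    ultimately show ?thesis using IH by simp
  next
    case False
    \<comment> \<open>The variable \<open>i\<close> survives in \<open>\<rho>\<close>, so
      \<open>\<mu>\<close> has at most \<open>size \<nu>\<close> variables, fewer than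
      \<open>add_mset k \<nu>\<close> has parts; the case of equality cannot occur.\<close>
    have "set_mset \<rho> = set_mset \<mu>"
    proof (rule set_eqI)
      fix x
      have "count \<rho> x > 0 \<longleftrightarrow> count \<mu> x > 0"
        using False i(1) by (cases "x = i") (use i_in in \<open>auto simp: \<rho>_def\<close>)
      thus "x \<in># \<rho> \<longleftrightarrow> x \<in># \<mu>" by simp
    qed
    thus ?thesis using IH by simp
  qed
qed

section \<open>The power sum basis\<close>

lemma scoeff_sum: "scoeff (sum f A) \<mu> = (\<Sum>x\<in>A. scoeff (f x) \<mu>)"
  by (induction A rule: infinite_finite_induct) (simp_all add: zero_symfun.rep_eq plus_symfun.rep_eq)

lemma scoeff_diff: "scoeff (f - g) \<mu> = scoeff f \<mu> - scoeff g \<mu>"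
  unfolding minus_symfun_def plus_symfun.rep_eq uminus_symfun.rep_eq by simp

lemma scale_0_left: "scale 0 f = 0"
  by transfer simp

lemma scale_add_left: "scale (a + b) f = scale a f + scale b f"
  by transfer (simp add: distrib_right)

lemma scale_minus_left: "scale (- a) f = - scale a f"
  by transfer simp

lemma scale_scale: "scale a (scale b f) = scale (a * b) f"
  by transfer (simp add: mult.assoc)

lemma scale_1_left: "scale 1 f = f"
  by transfer simp

lemma scale_mult_left: "scale a f * g = scale a (f * g)"
  by (rule symfun_eqI)
     (simp add: times_symfun.rep_eq scale.rep_eq sum_distrib_left case_prod_unfold mult.assoc)

lemma scale_mult_right: "f * scale a g = scale a (f * g)"
  using scale_mult_left[of a g f] by (simp only: mult.commute)

lemma const_mult: "const a * f = scale a f"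
  by (simp add: scale_mult_left)

text \<open>Since \<open>h \<nu> 0 = 0\<close>, all three sums may run over the union of the
  supports, even if coefficients cancel in \<open>c + c'\<close>. It serves both expansions in power
  sums and their images under plethysm.\<close>

lemma sum_keys_add:
  fixes h :: "'b \<Rightarrow> 'c::comm_monoid_add \<Rightarrow> 'd::comm_monoid_add"
  assumes "\<And>\<nu>. h \<nu> 0 = 0" "\<And>\<nu> a b. h \<nu> (a + b) = h \<nu> a + h \<nu> b"
  shows "(\<Sum>\<nu>\<in>Poly_Mapping.keys (c + c'). h \<nu> (Poly_Mapping.lookup (c + c') \<nu>)) =
    (\<Sum>\<nu>\<in>Poly_Mapping.keys c. h \<nu> (Poly_Mapping.lookup c \<nu>)) +
    (\<Sum>\<nu>\<in>Poly_Mapping.keys c'. h \<nu> (Poly_Mapping.lookup c' \<nu>))"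
proof -
  let ?K = "Poly_Mapping.keys c \<union> Poly_Mapping.keys c'"
  have ext: "(\<Sum>\<nu>\<in>Poly_Mapping.keys e. h \<nu> (Poly_Mapping.lookup e \<nu>)) =
      (\<Sum>\<nu>\<in>?K. h \<nu> (Poly_Mapping.lookup e \<nu>))" if "Poly_Mapping.keys e \<subseteq> ?K" for e
    using that by (intro sum.mono_neutral_left) (auto simp: assms(1) in_keys_iff)
  show ?thesis
    using ext[OF Poly_Mapping.keys_add] ext[of c] ext[of c']
    by (simp add: lookup_add assms(2) sum.distrib)
qed

text \<open>The indices \<open>g i\<close> may coincide: their coefficients then add up, and
  \<open>h\<close> is additive.\<close>

lemma sum_keys_sum_single:
  fixes h :: "'b \<Rightarrow> 'c::comm_monoid_add \<Rightarrow> 'd::comm_monoid_add"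
  assumes "\<And>\<nu>. h \<nu> 0 = 0" "\<And>\<nu> a b. h \<nu> (a + b) = h \<nu> a + h \<nu> b"
    and "c = (\<Sum>i\<in>I. Poly_Mapping.single (g i) (a i))"
  shows "(\<Sum>\<nu>\<in>Poly_Mapping.keys c. h \<nu> (Poly_Mapping.lookup c \<nu>)) = (\<Sum>i\<in>I. h (g i) (a i))"
  unfolding assms(3)
proof (induction I rule: infinite_finite_induct)
  case (insert i I)
  have "(\<Sum>\<nu>\<in>Poly_Mapping.keys (Poly_Mapping.single (g i) (a i)).
      h \<nu> (Poly_Mapping.lookup (Poly_Mapping.single (g i) (a i)) \<nu>)) = h (g i) (a i)"
    by (simp add: assms(1))
  thus ?case using insert by (simp add: sum_keys_add assms(1,2))
qed simp_all

text \<open>The predicate under the definite description in \<open>power_sum_expansion\<close>,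
  named so that uniqueness and existence can be proved separately.\<close>

definition is_expansion :: "ratqt symfun \<Rightarrow> (nat multiset \<Rightarrow>\<^sub>0 ratqt) \<Rightarrow> bool" where
  "is_expansion F c \<longleftrightarrow> (\<forall>\<nu>\<in>Poly_Mapping.keys c. 0 \<notin># \<nu>) \<and>
     F = (\<Sum>\<nu>\<in>Poly_Mapping.keys c. scale (Poly_Mapping.lookup c \<nu>) (power_sum_prod \<nu>))"

lemma is_expansion_sum:
  assumes "\<And>i. i \<in> I \<Longrightarrow> 0 \<notin># g i"
  shows "is_expansion (\<Sum>i\<in>I. scale (a i) (power_sum_prod (g i)))
           (\<Sum>i\<in>I. Poly_Mapping.single (g i) (a i))"
  unfolding is_expansion_def
proof (intro conjI ballI)
  fix \<nu> assume "\<nu> \<in> Poly_Mapping.keys (\<Sum>i\<in>I. Poly_Mapping.single (g i) (a i))"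
  hence "\<nu> \<in> g ` I"
    using Poly_Mapping.keys_sum[of "\<lambda>i. Poly_Mapping.single (g i) (a i)" I]
    by (auto split: if_splits)
  thus "0 \<notin># \<nu>" using assms by auto
qed (rule sum_keys_sum_single[of "\<lambda>\<nu> a. scale a (power_sum_prod \<nu>)",
       OF scale_0_left scale_add_left refl, symmetric])

lemma is_expansion_add:
  assumes "is_expansion F c" "is_expansion G e"
  shows "is_expansion (F + G) (c + e)"
proof -
  have "\<forall>\<nu>\<in>Poly_Mapping.keys (c + e). 0 \<notin># \<nu>"
    using assms Poly_Mapping.keys_add[of c e] unfolding is_expansion_def by blast
  thus ?thesis
    using assms sum_keys_add[of "\<lambda>\<nu> a. scale a (power_sum_prod \<nu>)" c e,
        OF scale_0_left scale_add_left]
    by (simp add: is_expansion_def)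
qed

text \<open>Take \<open>\<kappa>\<close> with the most parts in the support of \<open>c\<close>, and
  a monomial of type \<open>\<kappa>\<close>. By triangularity no other product in the sum contains
  this monomial, so the coefficient of \<open>\<kappa>\<close> would have to vanish.\<close>

lemma power_sum_prod_independent:
  assumes "is_expansion 0 c"
  shows "c = 0"
proof (rule ccontr)
  assume "c \<noteq> 0"
  define K where "K = Poly_Mapping.keys c"
  have K: "finite K" "K \<noteq> {}" using \<open>c \<noteq> 0\<close> by (auto simp: K_def)
  define N where "N = Max (size ` K)"
  have "N \<in> size ` K" using K by (simp add: N_def)
  then obtain \<kappa> where l: "\<kappa> \<in> K" "size \<kappa> = N" by auto
  have le: "size \<nu> \<le> size \<kappa>" if "\<nu> \<in> K" for \<nu> using that K l(2) by (simp add: N_def)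
  have pos: "0 \<notin># \<nu>" if "\<nu> \<in> K" for \<nu> using that assms by (simp add: is_expansion_def K_def)
  obtain \<mu> :: "nat multiset" where \<mu>: "exponents \<mu> = \<kappa>" using ex_exponents_eq[OF pos[OF l(1)]] by blast
  hence card: "card (set_mset \<mu>) = size \<kappa>" using size_exponents[of \<mu>] by simp
  have "0 = (\<Sum>\<nu>\<in>K. scale (Poly_Mapping.lookup c \<nu>) (power_sum_prod \<nu>))"
    using assms unfolding is_expansion_def K_def by (rule conjunct2)
  hence "0 = scoeff (\<Sum>\<nu>\<in>K. scale (Poly_Mapping.lookup c \<nu>) (power_sum_prod \<nu>)) \<mu>"
    by (simp add: zero_symfun.rep_eq flip: \<open>0 = _\<close>)
  also have "\<dots> = (\<Sum>\<nu>\<in>K. Poly_Mapping.lookup c \<nu> * scoeff (power_sum_prod \<nu>) \<mu>)"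
    by (simp add: scoeff_sum scale.rep_eq)
  also have "\<dots> = (\<Sum>\<nu>\<in>{\<kappa>}. Poly_Mapping.lookup c \<nu> * scoeff (power_sum_prod \<nu>) \<mu>)"
  proof (rule sum.mono_neutral_right)
    show "\<forall>\<nu>\<in>K - {\<kappa>}. Poly_Mapping.lookup c \<nu> * scoeff (power_sum_prod \<nu>) \<mu> = 0"
    proof
      fix \<nu> assume \<nu>: "\<nu> \<in> K - {\<kappa>}"
      have "scoeff (power_sum_prod \<nu>) \<mu> = 0"
        using scoeff_power_sum_prod_nonzero[OF pos, of \<nu> \<mu>] \<nu> le[of \<nu>] card \<mu> by force
      thus "Poly_Mapping.lookup c \<nu> * scoeff (power_sum_prod \<nu>) \<mu> = 0" by simp
    qed
  qed (use K l in auto)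
  finally have "Poly_Mapping.lookup c \<kappa> * scoeff (power_sum_prod \<kappa>) \<mu> = 0" by simp
  moreover have "scoeff (power_sum_prod \<kappa>) \<mu> > 0"
    using scoeff_power_sum_prod_exponents_pos[OF pos[OF l(1)] \<mu>] .
  moreover have "Poly_Mapping.lookup c \<kappa> \<noteq> 0" using l(1) by (simp add: K_def in_keys_iff)
  ultimately show False by simp
qed

lemma is_expansion_unique:
  assumes "is_expansion F c" "is_expansion F e"
  shows "c = e"
proof -
  have "is_expansion (- F) (- e)"
    using assms(2) by (simp add: is_expansion_def scale_minus_left sum_negf)
  from is_expansion_add[OF assms(1) this] have "c + - e = 0"
    by (intro power_sum_prod_independent) simp
  thus ?thesis by (simp add: add_eq_0_iff)
qed

text \<open>Induction on the bound for the number of distinct variables: a combination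
  \<open>G\<close> of products with exactly \<open>N\<close> parts removes all monomials of
  \<open>F\<close> with \<open>N\<close> variables and adds none with more.\<close>

lemma is_expansion_exists_bounded:
  assumes "\<And>\<mu>. scoeff F \<mu> \<noteq> 0 \<Longrightarrow> card (set_mset \<mu>) < N"
  shows "\<exists>c. is_expansion F c"
  using assms
proof (induction N arbitrary: F)
  case 0
  have "F = 0" using 0 by (intro symfun_eqI) (auto simp: zero_symfun.rep_eq)
  hence "is_expansion F 0" by (simp add: is_expansion_def)
  thus ?case by blast
next
  case (Suc N)
  obtain d where d: "\<And>\<mu>. size \<mu> > d \<Longrightarrow> scoeff F \<mu> = 0" using scoeff[of F] by auto
  \<comment> \<open>The bound \<open>d\<close> on the degree also bounds the exponents, so the
    finite set \<open>L\<close> contains the type of every monomial of \<open>F\<close> with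
    \<open>N\<close> variables.\<close>
  define L where "L = {\<nu>. set_mset \<nu> \<subseteq> {1..d} \<and> size \<nu> = N}"
  have finL: "finite L"
    using finite_multisets_of_size[of "{1..d}" N] by (simp add: L_def multisets_of_size_def)
  have pos: "0 \<notin># \<nu>" if "\<nu> \<in> L" for \<nu> using that by (auto simp: L_def)
  define rep :: "nat multiset \<Rightarrow> nat multiset" where "rep \<nu> = (SOME \<mu>. exponents \<mu> = \<nu>)" for \<nu>
  have rep: "exponents (rep \<nu>) = \<nu>" if "\<nu> \<in> L" for \<nu>
    unfolding rep_def using someI_ex[OF ex_exponents_eq[OF pos[OF that]]] .
  \<comment> \<open>Chosen so that \<open>F\<close> and \<open>G\<close> agree at
    \<open>rep \<nu>\<close>, hence by symmetry at every monomial of type \<open>\<nu>\<close>; the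
    denominator is positive.\<close>
  define a where "a \<nu> = scoeff F (rep \<nu>) / scoeff (power_sum_prod \<nu>) (rep \<nu>)" for \<nu>
  define G where "G = (\<Sum>\<nu>\<in>L. scale (a \<nu>) (power_sum_prod \<nu>))"
  have G: "scoeff G \<mu> = (\<Sum>\<nu>\<in>L. a \<nu> * scoeff (power_sum_prod \<nu>) \<mu>)" for \<mu>
    by (simp add: G_def scoeff_sum scale.rep_eq)
  have vanish: "scoeff (power_sum_prod \<nu>) \<mu> = 0"
    if "\<nu> \<in> L" "card (set_mset \<mu>) \<ge> N" "exponents \<mu> \<noteq> \<nu>" for \<nu> \<mu>
    using scoeff_power_sum_prod_nonzero[OF pos, of \<nu> \<mu>] that by (force simp: L_def)
  have "scoeff (F - G) \<mu> = 0" if \<mu>: "card (set_mset \<mu>) \<ge> N" for \<mu>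
  proof (cases "exponents \<mu> \<in> L")
    case True
    let ?\<nu> = "exponents \<mu>"
    have "scoeff G \<mu> = (\<Sum>\<nu>\<in>{?\<nu>}. a \<nu> * scoeff (power_sum_prod \<nu>) \<mu>)"
      unfolding G by (rule sum.mono_neutral_right) (use finL True vanish \<mu> in auto)
    also have "\<dots> = a ?\<nu> * scoeff (power_sum_prod ?\<nu>) (rep ?\<nu>)"
      by (simp add: scoeff_cong_exponents[OF rep[OF True]])
    also have "\<dots> = scoeff F (rep ?\<nu>)"
      using scoeff_power_sum_prod_exponents_pos[OF pos[OF True] rep[OF True]] by (simp add: a_def)
    also have "\<dots> = scoeff F \<mu>"
      by (rule scoeff_cong_exponents[OF rep[OF True]])
    finally show ?thesis by (simp add: scoeff_diff)
  next
    case False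
    have "scoeff G \<mu> = 0" unfolding G
      by (rule sum.neutral) (use vanish[OF _ \<mu>] False in auto)
    moreover have "scoeff F \<mu> = 0"
    \<comment> \<open>A monomial of \<open>F\<close> with exactly \<open>N\<close> variables whose
      type is not in \<open>L\<close> has an exponent above \<open>d\<close>, contrary to the degree
      bound.\<close>
    proof (rule ccontr)
      assume nz: "scoeff F \<mu> \<noteq> 0"
      hence "card (set_mset \<mu>) = N" using Suc.prems[of \<mu>] \<mu> by simp
      with False have "\<not> count \<mu> ` set_mset \<mu> \<subseteq> {1..d}"
        by (simp add: L_def size_exponents set_mset_exponents)
      then obtain i where i: "i \<in># \<mu>" "count \<mu> i \<notin> {1..d}" by blast
      hence "count \<mu> i > d" by (auto simp flip: count_greater_zero_iff)
      hence "size \<mu> > d" using count_le_size[of \<mu> i] by linarith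
      thus False using d nz by simp
    qed
    ultimately show ?thesis by (simp add: scoeff_diff)
  qed
  hence "\<exists>c. is_expansion (F - G) c" by (intro Suc.IH) (meson not_less)
  then obtain c where "is_expansion (F - G) c" by blast
  moreover have "is_expansion G (\<Sum>\<nu>\<in>L. Poly_Mapping.single \<nu> (a \<nu>))"
    unfolding G_def by (rule is_expansion_sum) (rule pos)
  ultimately have "is_expansion (F - G + G) (c + (\<Sum>\<nu>\<in>L. Poly_Mapping.single \<nu> (a \<nu>)))"
    by (rule is_expansion_add)
  thus ?case by auto
qed

lemma is_expansion_exists: "\<exists>c. is_expansion F c"
proof -
  obtain d where d: "\<And>\<mu>. size \<mu> > d \<Longrightarrow> scoeff F \<mu> = 0" using scoeff[of F] by auto
  show ?thesis
  proof (rule is_expansion_exists_bounded)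
    fix \<mu> assume "scoeff F \<mu> \<noteq> 0"
    hence "size \<mu> \<le> d" using d by (meson not_less)
    thus "card (set_mset \<mu>) < Suc d"
      \<comment> \<open>Each variable that occurs contributes at least 1 to the degree.\<close>
      using size_multiset_overloaded_eq[of \<mu>] sum_mono[of "set_mset \<mu>" "\<lambda>_. 1" "count \<mu>"] by simp
  qed
qed

lemma power_sum_expansion_eqI:
  assumes "is_expansion F c"
  shows "power_sum_expansion F = c"
  unfolding power_sum_expansion_def is_expansion_def[symmetric]
  using assms is_expansion_unique by (intro the_equality) auto

lemma is_expansion_power_sum_expansion: "is_expansion F (power_sum_expansion F)"
  using is_expansion_exists power_sum_expansion_eqI by metis

section \<open>Plethysm and the operators\<close>

lemma fls_const_const_0_mult: "fls_const (const 0) * f = 0"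
  by (simp add: scale_0_left)

lemma fls_const_const_add_mult:
  "fls_const (const (a + b)) * f = fls_const (const a) * f + fls_const (const b) * f"
  by (simp add: scale_add_left distrib_right flip: fls_plus_const)

text \<open>By uniqueness, the sum of the two expansions is the expansion of
  \<open>F + G\<close>.\<close>

lemma plethysm_add: "plethysm (F + G) E = plethysm F E + plethysm G E"
proof -
  have "power_sum_expansion (F + G) = power_sum_expansion F + power_sum_expansion G"
    by (intro power_sum_expansion_eqI is_expansion_add is_expansion_power_sum_expansion)
  thus ?thesis
    unfolding plethysm_def
    using sum_keys_add[of "\<lambda>\<nu> a. fls_const (const a) * (\<Prod>k\<in>#\<nu>. pleth_p k E)",
        OF fls_const_const_0_mult fls_const_const_add_mult]
    by simp
qed

lemma plethysm_uminus: "plethysm (- F) E = - plethysm F E"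
  \<comment> \<open>The instance \<open>0 + 0\<close> gives \<open>plethysm 0 E = 0\<close>.\<close>
  using plethysm_add[of F "- F" E] plethysm_add[of 0 0 E] by (simp add: add_eq_0_iff)

text \<open>Multiplying by \<open>power_sum k\<close> adds a part \<open>k\<close> to every index of
  the expansion. This instance of multiplicativity suffices, as \<open>e_1\<close> is itself a power
  sum.\<close>

lemma plethysm_power_sum_mult:
  assumes "k > 0"
  shows "plethysm (power_sum k * F) E = pleth_p k E * plethysm F E"
proof -
  define c where "c = power_sum_expansion F"
  define K where "K = Poly_Mapping.keys c"
  have c: "is_expansion F c" by (simp add: c_def is_expansion_power_sum_expansion)
  have F: "F = (\<Sum>\<nu>\<in>K. scale (Poly_Mapping.lookup c \<nu>) (power_sum_prod \<nu>))"
    using c unfolding is_expansion_def K_def by (rule conjunct2)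
  define e where "e = (\<Sum>\<nu>\<in>K. Poly_Mapping.single (add_mset k \<nu>) (Poly_Mapping.lookup c \<nu>))"
  have "power_sum k * F =
      (\<Sum>\<nu>\<in>K. scale (Poly_Mapping.lookup c \<nu>) (power_sum_prod (add_mset k \<nu>)))"
    by (subst F) (simp add: sum_distrib_left scale_mult_right)
  moreover have "is_expansion \<dots> e"
    unfolding e_def by (rule is_expansion_sum) (use assms c in \<open>auto simp: is_expansion_def K_def\<close>)
  ultimately have "power_sum_expansion (power_sum k * F) = e"
    by (simp add: power_sum_expansion_eqI)
  hence "plethysm (power_sum k * F) E =
      (\<Sum>\<nu>\<in>K. fls_const (const (Poly_Mapping.lookup c \<nu>)) * (\<Prod>k\<in>#add_mset k \<nu>. pleth_p k E))"
    unfolding plethysm_def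
    using sum_keys_sum_single[of "\<lambda>\<nu> a. fls_const (const a) * (\<Prod>k\<in>#\<nu>. pleth_p k E)",
        OF fls_const_const_0_mult fls_const_const_add_mult e_def]
    by simp
  also have "\<dots> = pleth_p k E * plethysm F E"
    unfolding plethysm_def c_def[symmetric] K_def[symmetric]
    by (simp add: sum_distrib_left mult.left_commute)
  finally show ?thesis .
qed

section \<open>The first power sum and \<open>e_1\<close>\<close>

lemma raise_qt_1_left: "raise_qt 1 x = x"
proof -
  have [simp]: "pcompose p (monom 1 (Suc 0)) = p" for p :: "'b::comm_ring_1 poly"
    using pcompose_idR[of p] by (simp add: monom_altdef)
  have "raise_poly 1 p = p" for p by (simp add: raise_poly_def)
  thus ?thesis by (cases x) (simp add: raise_qt_Fract)
qed

lemma raise_sym_1: "raise_sym 1 f = f"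
  by (rule symfun_eqI) (simp add: raise_sym.rep_eq raise_qt_1_left[simplified])

lemma pleth_p_1: "pleth_p 1 E = E"
  by (rule fls_eqI) (simp add: pleth_p_def raise_sym_1[simplified] fls_nth_compose_power)

lemma elem_sym_1: "elem_sym 1 = power_sum 1"
proof (rule symfun_eqI)
  fix \<mu> :: "nat multiset"
  show "scoeff (elem_sym 1) \<mu> = scoeff (power_sum 1 :: ratqt symfun) \<mu>"
    unfolding power_sum_def raise_sym_1 elem_sym.rep_eq varsum.rep_eq
    \<comment> \<open>In degree one no variable can occur twice, so squarefreeness is
      automatic.\<close>
    using count_le_size[of \<mu>] by auto
qed

section \<open>The commutation relation and the operators \<open>Q_op 1 n\<close>\<close>

lemma D_op_uminus: "D_op n (- F) = - D_op n F"
  by (simp add: D_op_def plethysm_uminus)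

text \<open>As \<open>e_1 = p_1\<close> and \<open>p_1[E] = E\<close>, the substitution turns the
  factor \<open>e_1\<close> into \<open>E = X + M/z\<close>, which multiplies the series defining
  \<open>D_op n F\<close>.\<close>

lemma D_op_e1_op: "D_op n (e1_op F) = e1_op (D_op n F) + scale MM (D_op (n + 1) F)"
proof -
  define E where "E = fls_const varsum + fls_const (const MM) * fls_X_inv"
  define A where "A = plethysm F E * fps_to_fls (Omega (- (fls_X * fls_const varsum)))"
  have D: "D_op k F = A $$ k" for k by (simp add: D_op_def A_def E_def)
  have vs: "elem_sym 1 = (varsum :: ratqt symfun)"
    by (simp only: elem_sym_1 power_sum_def raise_sym_1)
  have "D_op n (e1_op F) = (E * A) $$ n"
    using plethysm_power_sum_mult[of 1 F E]
    by (simp only: D_op_def e1_op_def elem_sym_1 pleth_p_1 A_def E_def[symmetric] mult.assoc)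
  \<comment> \<open>Multiplication by \<open>1/z\<close> lowers exponents by one, so the coefficient
    at \<open>n\<close> comes from \<open>A\<close> at \<open>n + 1\<close>.\<close>
  also have "\<dots> = varsum * A $$ n + const MM * A $$ (n + 1)"
    by (simp add: E_def distrib_right mult.assoc fls_X_inv_times_conv_shift(1))
  finally show ?thesis by (simp add: D e1_op_def vs[simplified] const_mult)
qed

lemma MM_nonzero: "MM \<noteq> 0"
  by (simp add: MM_def qq_def tt_def One_fract_def Zero_fract_def eq_fract one_pCons)

lemma Q_op_1: "Q_op 1 n = D_op (int n)"
proof (induction n)
  case 0
  show ?case by (simp add: Q_op.simps)
next
  case (Suc n)
  have "Q_op 1 (Suc n) = (\<lambda>F. scale (1 / MM) (commutator (Q_op 0 1) (Q_op 1 n) F))"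
    by (subst Q_op.simps) (simp add: Split_def)
  also have "Q_op 0 1 = (\<lambda>F. - e1_op F)"
    by (simp add: Q_op.simps)
  \<comment> \<open>The sign in \<open>Q_op 0 1\<close> reverses the commutator:
    \<open>[-e_1, D_n] = D_n e_1 - e_1 D_n = M D_(n+1)\<close>, and \<open>1/M\<close> cancels
    \<open>M\<close>.\<close>
  also have "(\<lambda>F. scale (1 / MM) (commutator (\<lambda>F. - e1_op F) (Q_op 1 n) F)) = D_op (int (Suc n))"
    unfolding Suc
    by (rule ext)
       (simp add: commutator_def D_op_uminus D_op_e1_op scale_scale MM_nonzero scale_1_left
         add.commute)
  finally show ?case .
qed

theorem theorem1p4:
  fixes m n :: nat
  assumes "coprime m n" and "m \<ge> 1"
  shows "(m > 1 \<longrightarrow> (\<forall>a b c d. Split m n = ((a, b), (c, d)) \<longrightarrow>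
            Q_op m n = (\<lambda>F. scale (1 / MM) (commutator (Q_op c d) (Q_op a b) F))))
       \<and> (m = 1 \<longrightarrow> Q_op 1 n = D_op (int n))"
proof (intro conjI impI allI)
  fix a b c d
  assume "m > 1" and "Split m n = ((a, b), (c, d))"
  \<comment> \<open>For \<open>n = 0\<close> coprimality would force \<open>m = 1\<close>. With
    \<open>n \<ge> 1\<close> and \<open>m > 1\<close> the recursive branch of \<open>Q_op\<close>
    applies.\<close>
  moreover from this have "n \<ge> 1" using assms(1) by (cases n) auto
  ultimately show "Q_op m n = (\<lambda>F. scale (1 / MM) (commutator (Q_op c d) (Q_op a b) F))"
    using assms by (subst Q_op.simps) simp
qed (rule Q_op_1)

end
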